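(* Let $N\ge2$ and let $\mathbf{C}=\mathcal{C}\times\mathbb{R}^{N-2}\subset\mathbb{R}^N$, where $\mathcal{C}\subset\mathbb{R}^2$ is a closed convex set of class $C^1$ with nonempty interior. Then $\mathbf{C}$ satisfies the $\lambda$-ABP property for every $\lambda\in(-1,1)$.
   Context: Let $B_1$ be the open unit ball of $\mathbb{R}^N$ centered at the origin and $B^\lambda=\{x\in B_1: x\cdot e_N>\lambda\}$; $|\cdot|$ is Lebesgue measure. For a closed convex set $\mathbf{C}\subset\mathbb{R}^N$ with nonempty interior and of class $C^1$ (i.e. with $C^1$ boundary), $\nu_{\mathbf{C}}(x)$ denotes the outer unit normal to $\mathbf{C}$ at $x\in\partial\mathbf{C}$. For $K\subset\partial\mathbf{C}$, $v:K\to\mathbb{R}$ and $x\in K$, the subdifferential is $$J_Kv(x)=\{\xi\in\mathbb{R}^N:\ v(y)-v(x)\ge\xi\cdot(y-x)\ \text{ for all } y\in K\},$$ and $$\mathcal{B}^\lambda_v=\bigcup_{x\in K}\{\xi\in J_Kv(x):\ \xi\cdot\nu_{\mathbf{C}}(x)>\lambda\}.$$ For $\lambda\in(-1,1)$, $\mathbf{C}$ has the $\lambda$-ABP property if for every finite nonempty subset $K\subset\partial\mathbf{C}$ and every function $v:K\to\mathbb{R}$ one has $|\mathcal{B}^\lambda_v\cap B_1|\ge|B^\lambda|$. *)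

theory Defs
  imports "HOL-Analysis.Analysis"
begin

section \<open>Sets with \<open>C\<^sup>1\<close> boundary and their outer unit normal\<close>

text \<open>
  Near \<open>p\<close>, the set \<open>S\<close> is the region below the graph, in the direction of the unit vector \<open>u\<close>,
  of a \<open>C\<^sup>1\<close> function \<open>g\<close> with gradient \<open>G\<close>. Instead of rotating coordinates so that \<open>u\<close> becomes
  the last coordinate direction, \<open>g\<close> is a function on the whole space that is constant along \<open>u\<close>,
  that is, a function of the component orthogonal to \<open>u\<close>.
\<close>

definition C1_graph_at ::
    "'a::euclidean_space set \<Rightarrow> 'a \<Rightarrow> 'a \<Rightarrow> ('a \<Rightarrow> real) \<Rightarrow> ('a \<Rightarrow> 'a) \<Rightarrow> real \<Rightarrow> bool" where
  "C1_graph_at S p u g G r \<longleftrightarrow>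
     norm u = 1 \<and> r > 0 \<and>
     (\<forall>x t. g (x + t *\<^sub>R u) = g x) \<and>
     (\<forall>x. (g has_derivative (\<lambda>h. G x \<bullet> h)) (at x)) \<and>
     continuous_on UNIV G \<and>
     S \<inter> ball p r = {x \<in> ball p r. x \<bullet> u \<le> g x}"

definition C1_boundary :: "'a::euclidean_space set \<Rightarrow> bool" where
  "C1_boundary S \<longleftrightarrow> (\<forall>p \<in> frontier S. \<exists>u g G r. C1_graph_at S p u g G r)"

text \<open>
  Locally \<open>S\<close> is \<open>{x. x \<bullet> u - g x \<le> 0}\<close>, so the outer unit normal is the normalized gradient
  \<open>u - G p\<close> of this defining function; it does not vanish because \<open>G p\<close> is orthogonal to \<open>u\<close>.
  By \<open>C1_graph_normal_unique\<close> below it does not depend on the graph representation.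
\<close>

definition outer_unit_normal :: "'a::euclidean_space set \<Rightarrow> 'a \<Rightarrow> 'a" where
  "outer_unit_normal S p = (THE \<nu>. \<exists>u g G r. C1_graph_at S p u g G r \<and> \<nu> = sgn (u - G p))"

lemma C1_graph_gradient_nonzero:
  assumes "C1_graph_at S p u g G r"
  shows "u - G p \<noteq> 0"
proof -
  have d: "(g has_derivative (\<lambda>h. G p \<bullet> h)) (at p)" and u: "norm u = 1"
    and inv: "\<And>x t. g (x + t *\<^sub>R u) = g x"
    using assms by (auto simp: C1_graph_at_def)
  have l: "((\<lambda>t. p + t *\<^sub>R u) has_derivative (\<lambda>t. t *\<^sub>R u)) (at (0::real))"
    by (auto intro!: derivative_eq_intros)
  have "((\<lambda>t. g (p + t *\<^sub>R u)) has_derivative (\<lambda>t. G p \<bullet> (t *\<^sub>R u))) (at (0::real))"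
    using has_derivative_compose[OF l, of g "\<lambda>h. G p \<bullet> h"] d by simp
  moreover have "((\<lambda>t. g (p + t *\<^sub>R u)) has_derivative (\<lambda>t. 0)) (at (0::real))"
    by (simp add: inv)
  ultimately have "(\<lambda>t::real. G p \<bullet> (t *\<^sub>R u)) = (\<lambda>t. 0)"
    by (rule has_derivative_unique)
  then have "G p \<bullet> (1 *\<^sub>R u) = 0" by (rule fun_cong)
  then have "(u - G p) \<bullet> u = 1"
    using u by (simp add: inner_diff_left dot_square_norm)
  then show ?thesis by auto
qed

lemma C1_graph_frontier_eq:
  assumes c: "C1_graph_at S p u g G r" and p: "p \<in> frontier S"
  shows "p \<bullet> u = g p"
proof -
  let ?f = "\<lambda>x. x \<bullet> u - g x"
  have r: "r > 0" and eq: "S \<inter> ball p r = {x \<in> ball p r. x \<bullet> u \<le> g x}"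
    and d: "\<And>x. (g has_derivative (\<lambda>h. G x \<bullet> h)) (at x)"
    using c by (simp_all add: C1_graph_at_def)
  have S: "x \<in> S \<longleftrightarrow> ?f x \<le> 0" if "x \<in> ball p r" for x
  proof -
    have "x \<in> S \<inter> ball p r \<longleftrightarrow> x \<in> {x \<in> ball p r. x \<bullet> u \<le> g x}" by (simp only: eq)
    with that show ?thesis by simp
  qed
  have cg: "continuous_on UNIV g"
    by (rule has_derivative_continuous_on, rule d)
  have cf: "continuous_on UNIV ?f" by (intro continuous_intros cg)
  have o1: "open ({x. ?f x < 0} \<inter> ball p r)"
    using open_Collect_less[OF cf, of "\<lambda>_. 0"] by (intro open_Int) auto
  have o2: "open ({x. ?f x > 0} \<inter> ball p r)"
    using open_Collect_less[OF _ cf, of "\<lambda>_. 0"] by (intro open_Int) auto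
  have "\<not> ?f p < 0"
  proof
    assume "?f p < 0"
    then have "p \<in> {x. ?f x < 0} \<inter> ball p r" using r by simp
    moreover have "{x. ?f x < 0} \<inter> ball p r \<subseteq> S"
    proof
      fix x assume "x \<in> {x. ?f x < 0} \<inter> ball p r"
      then show "x \<in> S" using S[of x] by simp
    qed
    ultimately have "p \<in> interior S" by (rule interiorI[OF o1])
    then show False using p by (simp add: frontier_def)
  qed
  moreover have "\<not> ?f p > 0"
  proof
    assume "?f p > 0"
    then have "p \<in> {x. ?f x > 0} \<inter> ball p r" using r by simp
    moreover have "{x. ?f x > 0} \<inter> ball p r \<subseteq> - S"
    proof
      fix x assume "x \<in> {x. ?f x > 0} \<inter> ball p r"
      then show "x \<in> - S" using S[of x] by simp
    qed
    ultimately have "p \<in> interior (- S)" by (rule interiorI[OF o2])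
    then show False using p by (simp add: frontier_def interior_complement)
  qed
  ultimately show ?thesis by simp
qed

lemma C1_graph_derivative:
  assumes "C1_graph_at S p u g G r"
  shows "((\<lambda>t. (p + t *\<^sub>R h) \<bullet> u - g (p + t *\<^sub>R h)) has_real_derivative (u - G p) \<bullet> h) (at 0)"
proof -
  have d: "(g has_derivative (\<lambda>h. G p \<bullet> h)) (at p)"
    using assms by (auto simp: C1_graph_at_def)
  have l: "((\<lambda>t. p + t *\<^sub>R h) has_derivative (\<lambda>t. t *\<^sub>R h)) (at (0::real))"
    by (auto intro!: derivative_eq_intros)
  have "((\<lambda>t. g (p + t *\<^sub>R h)) has_derivative (\<lambda>t. G p \<bullet> (t *\<^sub>R h))) (at (0::real))"
    using has_derivative_compose[OF l, of g "\<lambda>h. G p \<bullet> h"] d by simp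
  moreover have "((\<lambda>t. (p + t *\<^sub>R h) \<bullet> u) has_derivative (\<lambda>t. (t *\<^sub>R h) \<bullet> u)) (at (0::real))"
    by (intro has_derivative_inner_left l)
  ultimately have "((\<lambda>t. (p + t *\<^sub>R h) \<bullet> u - g (p + t *\<^sub>R h)) has_derivative
      (\<lambda>t. (t *\<^sub>R h) \<bullet> u - G p \<bullet> (t *\<^sub>R h))) (at (0::real))"
    by (rule has_derivative_diff[rotated])
  moreover have "(\<lambda>t. (t *\<^sub>R h) \<bullet> u - G p \<bullet> (t *\<^sub>R h)) = (*) ((u - G p) \<bullet> h)"
    by (auto simp: fun_eq_iff algebra_simps inner_commute)
  ultimately show ?thesis by (simp add: has_field_derivative_def)
qed

lemma C1_graph_normal_unique:
  assumes c1: "C1_graph_at S p u1 g1 G1 r1" and c2: "C1_graph_at S p u2 g2 G2 r2"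
    and p: "p \<in> frontier S"
  shows "sgn (u1 - G1 p) = sgn (u2 - G2 p)"
proof (rule ccontr)
  define a where "a = u1 - G1 p"
  define b where "b = u2 - G2 p"
  assume "sgn (u1 - G1 p) \<noteq> sgn (u2 - G2 p)"
  then have ne: "sgn a \<noteq> sgn b" by (simp add: a_def b_def)
  have a0: "a \<noteq> 0" and b0: "b \<noteq> 0"
    using C1_graph_gradient_nonzero[OF c1] C1_graph_gradient_nonzero[OF c2] by (auto simp: a_def b_def)
  define h where "h = sgn b - sgn a"
  have n: "sgn a \<bullet> sgn a = 1" "sgn b \<bullet> sgn b = 1"
    using a0 b0 by (simp_all add: dot_square_norm norm_sgn)
  have "0 < h \<bullet> h" using ne by (simp add: h_def)
  then have lt: "sgn a \<bullet> sgn b < 1"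
    using n by (simp add: h_def inner_diff_left inner_diff_right inner_commute)
  have "sgn a \<bullet> h < 0" "sgn b \<bullet> h > 0"
    using lt n by (simp_all add: h_def inner_diff_right inner_commute)
  then have ah: "a \<bullet> h < 0" and bh: "b \<bullet> h > 0"
    using a0 b0 by (simp_all add: sgn_div_norm mult_less_0_iff zero_less_mult_iff)
  let ?f1 = "\<lambda>t. (p + t *\<^sub>R h) \<bullet> u1 - g1 (p + t *\<^sub>R h)"
  let ?f2 = "\<lambda>t. (p + t *\<^sub>R h) \<bullet> u2 - g2 (p + t *\<^sub>R h)"
  have z: "?f1 0 = 0" "?f2 0 = 0"
    using C1_graph_frontier_eq[OF c1 p] C1_graph_frontier_eq[OF c2 p] by simp_all
  obtain d1 where d1: "d1 > 0" "\<And>t. 0 < t \<Longrightarrow> t < d1 \<Longrightarrow> ?f1 t < 0"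
    using DERIV_neg_dec_right[OF C1_graph_derivative[OF c1, of h]] ah z by (auto simp: a_def)
  obtain d2 where d2: "d2 > 0" "\<And>t. 0 < t \<Longrightarrow> t < d2 \<Longrightarrow> ?f2 t > 0"
    using DERIV_pos_inc_right[OF C1_graph_derivative[OF c2, of h]] bh z by (auto simp: b_def)
  have r: "r1 > 0" "r2 > 0" using c1 c2 by (auto simp: C1_graph_at_def)
  have h0: "norm h > 0" using ah by auto
  define s where "s = Min {d1, d2, r1 / norm h, r2 / norm h}"
  define t where "t = s / 2"
  have "s > 0"
    using d1 d2 r h0 by (simp add: s_def)
  moreover have "s \<le> d1" "s \<le> d2" "s \<le> r1 / norm h" "s \<le> r2 / norm h"
    unfolding s_def by (auto intro!: Min_le)
  ultimately have t: "0 < t" "t < d1" "t < d2" "t < r1 / norm h" "t < r2 / norm h"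
    unfolding t_def by linarith+
  have "t * norm h < r1" "t * norm h < r2"
    using t h0 by (simp_all add: pos_less_divide_eq)
  then have "p + t *\<^sub>R h \<in> ball p r1" "p + t *\<^sub>R h \<in> ball p r2"
    using t by (simp_all add: dist_norm)
  moreover have "?f1 t < 0" by (rule d1(2)[OF t(1,2)])
  moreover have "?f2 t > 0" by (rule d2(2)[OF t(1,3)])
  moreover have "S \<inter> ball p r1 = {x \<in> ball p r1. x \<bullet> u1 \<le> g1 x}"
    and "S \<inter> ball p r2 = {x \<in> ball p r2. x \<bullet> u2 \<le> g2 x}"
    using c1 c2 by (simp_all add: C1_graph_at_def)
  ultimately have "p + t *\<^sub>R h \<in> S \<inter> ball p r1" "p + t *\<^sub>R h \<notin> S \<inter> ball p r2"
    by simp_all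
  then show False
    using \<open>p + t *\<^sub>R h \<in> ball p r2\<close> by simp
qed

lemma outer_unit_normal_eq:
  assumes "C1_graph_at S p u g G r" "p \<in> frontier S"
  shows "outer_unit_normal S p = sgn (u - G p)"
  unfolding outer_unit_normal_def
proof (rule the_equality)
  show "\<exists>u' g' G' r'. C1_graph_at S p u' g' G' r' \<and> sgn (u - G p) = sgn (u' - G' p)"
    using assms(1) by blast
next
  fix \<nu> assume "\<exists>u' g' G' r'. C1_graph_at S p u' g' G' r' \<and> \<nu> = sgn (u' - G' p)"
  then obtain u' g' G' r' where "C1_graph_at S p u' g' G' r'" "\<nu> = sgn (u' - G' p)"
    by (elim exE conjE)
  then show "\<nu> = sgn (u - G p)"
    using C1_graph_normal_unique[OF _ assms] by simp
qed


section \<open>The \<open>\<lambda>\<close>-ABP property\<close>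

text \<open>A function on \<open>K\<close> is represented by a total function of which only the values on \<open>K\<close> matter.\<close>

definition subdifferential :: "'a::euclidean_space set \<Rightarrow> ('a \<Rightarrow> real) \<Rightarrow> 'a \<Rightarrow> 'a set" where
  "subdifferential K v x = {\<xi>. \<forall>y\<in>K. v y - v x \<ge> \<xi> \<bullet> (y - x)}"

definition restricted_subgradients ::
    "'a::euclidean_space set \<Rightarrow> 'a set \<Rightarrow> ('a \<Rightarrow> real) \<Rightarrow> real \<Rightarrow> 'a set" where
  "restricted_subgradients C K v lam =
     (\<Union>x\<in>K. {\<xi> \<in> subdifferential K v x. \<xi> \<bullet> outer_unit_normal C x > lam})"

text \<open>The unit vector \<open>e\<close> plays the role of the last vector of the standard basis.\<close>

definition cap :: "'a::euclidean_space \<Rightarrow> real \<Rightarrow> 'a set" where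
  "cap e lam = {x \<in> ball 0 1. x \<bullet> e > lam}"

definition ABP_property :: "'a::euclidean_space \<Rightarrow> real \<Rightarrow> 'a set \<Rightarrow> bool" where
  "ABP_property e lam C \<longleftrightarrow>
     (\<forall>K v. finite K \<and> K \<noteq> {} \<and> K \<subseteq> frontier C \<longrightarrow>
        measure lebesgue (restricted_subgradients C K v lam \<inter> ball 0 1)
          \<ge> measure lebesgue (cap e lam))"


section \<open>Cylinders over planar sets\<close>

text \<open>
  The index type has no canonical first, second and last element, so the coordinates are numbered
  by a bijection \<open>coord\<close> from \<open>{1..CARD('n)}\<close> to the index type.
\<close>

definition cylinder :: "(nat \<Rightarrow> 'n) \<Rightarrow> (real ^ 2) set \<Rightarrow> (real ^ 'n) set" where
  "cylinder coord S = {x. vector [x $ coord 1, x $ coord 2] \<in> S}"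

end

theory Submission
  imports Defs
begin

text \<open>
  The proof is a transport argument along lines. For \<open>\<lambda>\<close> between \<open>-1\<close> and \<open>1\<close> there is a
  rotation invariant density on the unit ball, with values in \<open>[0, 1]\<close>, whose integral along every
  line equals the length of the part of that line in the cap \<open>cap \<nu> \<lambda>\<close>, where \<open>\<nu>\<close> is a unit
  direction of the line. As the density does not depend on \<open>\<nu>\<close>, it can be compared with caps in
  several directions at once. Its total mass is the volume of a cap of height \<open>\<lambda>\<close> in any
  direction (\<open>emeasure_cap_le_density\<close> states that it is at least that).

  The subdifferentials \<open>J x\<close> of \<open>v\<close> at the points \<open>x \<in> K\<close> cover the space, because every \<open>\<xi>\<close>
  belongs to the subdifferential at a minimizer of \<open>v y - \<xi> \<bullet> y\<close>. Convexity of the body says that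
  the outer normal \<open>\<nu> x\<close> satisfies \<open>\<nu> x \<bullet> (y - x) \<le> 0\<close>, so \<open>J x\<close> is closed under translation by
  nonnegative multiples of \<open>\<nu> x\<close>: a line in direction \<open>\<nu> x\<close> meets it in an upward closed set \<open>T\<close>.
  On such a line the mass of \<open>T\<close> is at most the length of \<open>T\<close> in the cap. If \<open>T\<close> contains
  everything above height \<open>\<lambda>\<close>, the right-hand side is the integral of the density along the whole
  line; otherwise \<open>T\<close> lies entirely above \<open>\<lambda>\<close>, and it is enough that the density is at most \<open>1\<close>
  and vanishes off the ball (\<open>nn_integral_circle_fraction_upward_closed\<close>). Integrating over all
  lines in direction \<open>\<nu> x\<close> gives \<open>density_cell_le_cap\<close>, and summing over \<open>x\<close>, with ties broken so
  that the cells are disjoint, gives \<open>emeasure_cap_le_subgradients\<close>.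

  The density is the one suggested by Archimedes' theorem that the height of a uniform point of a
  sphere in three-space is uniformly distributed. A line at distance \<open>d\<close> from the origin meets the
  ball in a segment of half-length \<open>c = sqrt (1 - d\<^sup>2)\<close>. On a sphere of radius \<open>c\<close>, the plane at
  coordinate \<open>t\<close> cuts out a circle of radius \<open>sqrt (c\<^sup>2 - t\<^sup>2)\<close>, and the fraction of that circle at
  height above \<open>\<lambda>\<close> averages, over \<open>t\<close>, for \<open>\<bar>\<lambda>\<bar> \<le> c\<close> to the fraction \<open>(c - \<lambda>) / (2 * c)\<close> of the sphere at
  height above \<open>\<lambda>\<close>. The radius of the circle is \<open>sqrt (1 - (norm q)\<^sup>2)\<close> at the point \<open>q\<close> of the
  line with coordinate \<open>t\<close>, so the fraction is a function of \<open>norm q\<close> alone.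

  All this holds for closed convex sets with \<open>C\<^sup>1\<close> boundary (\<open>ABP_property_convex_C1\<close>). A cylinder
  over a planar set of this kind is again of this kind, because the graphs that describe the planar
  boundary can be pulled back along the projection (\<open>C1_boundary_vimage\<close>).
\<close>

section \<open>The fraction of a circle above a given height\<close>

text \<open>
  The argument \<open>w\<close> is the square of the radius of the circle, centred at height \<open>0\<close>. Clamping the
  argument of \<open>arccos\<close> yields the values \<open>0\<close> and \<open>1\<close> when the circle lies on one side of the height
  \<open>lam\<close>, and the value \<open>0\<close> for \<open>w \<le> 0\<close> makes the density below vanish off the open ball.
\<close>

definition circle_fraction :: "real \<Rightarrow> real \<Rightarrow> real" where
  "circle_fraction lam w =
     (if w > 0 then arccos (max (- 1) (min 1 (lam / sqrt w))) / pi else 0)"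

lemma circle_fraction_nonneg: "0 \<le> circle_fraction lam w"
  by (simp add: circle_fraction_def arccos_lbound)

lemma circle_fraction_le_1: "circle_fraction lam w \<le> 1"
  by (simp add: circle_fraction_def arccos_ubound)

lemma circle_fraction_measurable [measurable]: "circle_fraction lam \<in> borel_measurable borel"
proof -
  have "continuous_on UNIV (\<lambda>x::real. arccos (max (- 1) (min 1 x)))"
    by (intro continuous_intros) auto
  then have [measurable]: "(\<lambda>x::real. arccos (max (- 1) (min 1 x))) \<in> borel_measurable borel"
    by (rule borel_measurable_continuous_onI)
  have "(\<lambda>w. if w > 0 then (\<lambda>x. arccos (max (- 1) (min 1 x))) (lam / sqrt w) / pi else 0)
      \<in> borel_measurable borel"
    by measurable
  then show ?thesis
    by (simp add: circle_fraction_def[abs_def])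
qed

text \<open>The points above \<open>- lam\<close> are the reflections of those below \<open>lam\<close>.\<close>

lemma circle_fraction_uminus:
  assumes "w > 0"
  shows "circle_fraction (- lam) w = 1 - circle_fraction lam w"
proof -
  have "max (- 1) (min 1 (- x)) = - max (- 1) (min 1 (x::real))" for x
    by (auto simp: max_def min_def)
  then show ?thesis
    using assms by (simp add: circle_fraction_def arccos_minus diff_divide_distrib)
qed

text \<open>
  Up to constant factors this is Archimedes' formula for the area of a spherical cap, computed by
  slicing the cap with planes parallel to its axis; \<open>L\<close> is the radius of its boundary circle. The
  antiderivative comes from integration by parts and a partial fraction decomposition of
  \<open>t\<^sup>2 / (c\<^sup>2 - t\<^sup>2)\<close>.
\<close>

lemma has_integral_arccos_slice:
  fixes lam c :: real
  assumes "0 < lam" "lam < c"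
  defines "L \<equiv> sqrt (c\<^sup>2 - lam\<^sup>2)"
  shows "((\<lambda>t. arccos (lam / sqrt (c\<^sup>2 - t\<^sup>2))) has_integral pi * (c - lam)) {- L..L}"
proof -
  (* The primitive of 1 / ((c^2 - t^2) * sqrt (L^2 - t^2)) is usually written with arctan; the arcsin
     form is the one that is continuous up to the endpoints. *)
  define H where "H t = t * arccos (lam / sqrt (c\<^sup>2 - t\<^sup>2)) - lam * arcsin (t / L)
      + c * arcsin (lam * t / (L * sqrt (c\<^sup>2 - t\<^sup>2)))" for t
  have c: "c > 0" using assms by simp
  have lc: "lam\<^sup>2 < c\<^sup>2" using assms by (intro power_strict_mono) auto
  have L: "L > 0" "L\<^sup>2 = c\<^sup>2 - lam\<^sup>2" using lc by (auto simp: L_def)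
  have S: "sqrt (c\<^sup>2 - t\<^sup>2) \<ge> lam" "c\<^sup>2 - t\<^sup>2 > 0" "c\<^sup>2 - t\<^sup>2 \<ge> lam\<^sup>2" if "t \<in> {-L..L}" for t
  proof -
    have "t\<^sup>2 \<le> L\<^sup>2" using that by (intro abs_le_square_iff[THEN iffD1]) auto
    then show *: "c\<^sup>2 - t\<^sup>2 \<ge> lam\<^sup>2" using L by simp
    then show "sqrt (c\<^sup>2 - t\<^sup>2) \<ge> lam" using assms by (intro real_le_rsqrt)
    have "lam\<^sup>2 > 0" using assms by simp
    with * show "c\<^sup>2 - t\<^sup>2 > 0" by linarith
  qed
  have key: "(lam * t)\<^sup>2 \<le> (L * sqrt (c\<^sup>2 - t\<^sup>2))\<^sup>2" if "t \<in> {-L..L}" for t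
  proof -
    have "(L * sqrt (c\<^sup>2 - t\<^sup>2))\<^sup>2 - (lam * t)\<^sup>2 = c\<^sup>2 * (c\<^sup>2 - t\<^sup>2 - lam\<^sup>2)"
      using S(2)[OF that] by (simp add: power_mult_distrib L(2)) (simp add: algebra_simps power2_eq_square)
    moreover have "c\<^sup>2 * (c\<^sup>2 - t\<^sup>2 - lam\<^sup>2) \<ge> 0" using S(3)[OF that] by simp
    ultimately show ?thesis by linarith
  qed
  have third: "\<bar>lam * t / (L * sqrt (c\<^sup>2 - t\<^sup>2))\<bar> \<le> 1" if "t \<in> {-L..L}" for t
  proof -
    have "\<bar>lam * t\<bar> \<le> \<bar>L * sqrt (c\<^sup>2 - t\<^sup>2)\<bar>"
      using key[OF that] by (simp add: abs_le_square_iff)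
    then show ?thesis
      using L S[OF that] by (simp add: abs_mult)
  qed
  have cont: "continuous_on {-L..L} H"
    unfolding H_def
  proof (intro continuous_intros ballI conjI)
    fix t assume t: "t \<in> {-L..L}"
    show "-1 \<le> lam * t / (L * sqrt (c\<^sup>2 - t\<^sup>2))" "lam * t / (L * sqrt (c\<^sup>2 - t\<^sup>2)) \<le> 1"
      using third[OF t] by linarith+
    show "L * sqrt (c\<^sup>2 - t\<^sup>2) \<noteq> 0" "sqrt (c\<^sup>2 - t\<^sup>2) \<noteq> 0" using S[OF t] L by auto
    show "lam / sqrt (c\<^sup>2 - t\<^sup>2) \<le> 1" "-1 \<le> lam / sqrt (c\<^sup>2 - t\<^sup>2)"
      using S[OF t] assms by (auto simp: divide_le_eq le_divide_eq)
    show "t / L \<le> 1" "-1 \<le> t / L" using t L by (auto simp: field_simps)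
  qed (use L in auto)
  have der: "(H has_vector_derivative arccos (lam / sqrt (c\<^sup>2 - t\<^sup>2))) (at t)"
    if t: "t \<in> {-L<..<L}" for t
  proof -
    have "t\<^sup>2 < L\<^sup>2" using t abs_le_square_iff[of L t] by auto
    define s where "s = sqrt (c\<^sup>2 - t\<^sup>2)"
    define r where "r = sqrt (L\<^sup>2 - t\<^sup>2)"
    have pos: "s > 0" "r > 0" "s\<^sup>2 = c\<^sup>2 - t\<^sup>2" "r\<^sup>2 = c\<^sup>2 - lam\<^sup>2 - t\<^sup>2" "c\<^sup>2 - t\<^sup>2 > 0"
      using \<open>t\<^sup>2 < L\<^sup>2\<close> L S[of t] t by (auto simp: s_def r_def)
    have sl: "s > lam"
    proof -
      have "lam\<^sup>2 < s\<^sup>2" using pos \<open>t\<^sup>2 < L\<^sup>2\<close> L by simp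
      then show ?thesis using pos(1) by (meson less_le not_less power2_less_imp_less)
    qed
    (* The square roots in the derivatives of the three inverse functions. *)
    have q1: "sqrt (1 - (lam / s)\<^sup>2) = r / s"
      using pos by (intro real_sqrt_unique) (auto simp: field_simps)
    have q2: "sqrt (1 - (t / L)\<^sup>2) = r / L"
      using pos L by (intro real_sqrt_unique) (auto simp: field_simps)
    have q3: "sqrt (1 - (lam * t / (L * s))\<^sup>2) = c * r / (L * s)"
    proof (intro real_sqrt_unique)
      have "(L * s)\<^sup>2 - (lam * t)\<^sup>2 = (c * r)\<^sup>2"
        by (simp add: power_mult_distrib L(2) pos(3,4)) (simp add: algebra_simps power2_eq_square)
      then have "(c * r)\<^sup>2 = (L * s)\<^sup>2 - (lam * t)\<^sup>2" by simp
      moreover have "(L * s)\<^sup>2 \<noteq> 0" using pos(1) L(1) by simp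
      ultimately show "(c * r / (L * s))\<^sup>2 = 1 - (lam * t / (L * s))\<^sup>2"
        by (simp add: power_divide diff_divide_distrib del: power_mult_distrib)
    qed (use pos(1,2) L(1) c in simp)
    have ds: "((\<lambda>t. sqrt (c\<^sup>2 - t\<^sup>2)) has_real_derivative - t / s) (at t)"
      using pos by (auto intro!: derivative_eq_intros simp: s_def field_simps)
    have d1: "((\<lambda>t. lam / sqrt (c\<^sup>2 - t\<^sup>2)) has_real_derivative lam * t / s ^ 3) (at t)"
    proof -
      have "((\<lambda>t. lam / sqrt (c\<^sup>2 - t\<^sup>2)) has_real_derivative
          (0 * s - lam * (- t / s)) / (s * s)) (at t)"
        using pos(1) unfolding s_def by (intro DERIV_divide DERIV_const ds[unfolded s_def]) auto
      moreover have "(0 * s - lam * (- t / s)) / (s * s) = lam * t / s ^ 3"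
        using pos(1) by (simp add: field_simps power3_eq_cube)
      ultimately show ?thesis by (simp only:)
    qed
    have d3: "((\<lambda>t. lam * t / (L * sqrt (c\<^sup>2 - t\<^sup>2))) has_real_derivative lam * c\<^sup>2 / (L * s ^ 3)) (at t)"
    proof -
      have "((\<lambda>t. lam * t / (L * sqrt (c\<^sup>2 - t\<^sup>2))) has_real_derivative
          (lam * (L * s) - (lam * t) * (L * (- t / s))) / ((L * s) * (L * s))) (at t)"
        using pos(1) L(1) unfolding s_def
        by (intro DERIV_divide DERIV_cmult ds[unfolded s_def])
          (auto intro!: derivative_eq_intros simp: s_def)
      moreover have "(lam * (L * s) - (lam * t) * (L * (- t / s))) / ((L * s) * (L * s))
          = lam * (s\<^sup>2 + t\<^sup>2) / (L * s ^ 3)"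
        using pos(1) L(1) by (simp add: field_simps power2_eq_square power3_eq_cube)
      moreover have "s\<^sup>2 + t\<^sup>2 = c\<^sup>2" using pos(3) by simp
      ultimately show ?thesis by (simp only:)
    qed
    have a1: "- 1 < lam / s" "lam / s < 1" using sl assms pos by (simp_all add: less_divide_eq)
    have a2: "- 1 < t / L" "t / L < 1" using t L by (simp_all add: less_divide_eq)
    have a3: "- 1 < lam * t / (L * s)" "lam * t / (L * s) < 1"
    proof -
      have "sqrt (1 - (lam * t / (L * s))\<^sup>2) > 0" using q3 pos L c by simp
      then have "(lam * t / (L * s))\<^sup>2 < 1" by simp
      then have "\<bar>lam * t / (L * s)\<bar> < 1" by (simp only: abs_square_less_1)
      then show "- 1 < lam * t / (L * s)" "lam * t / (L * s) < 1" by linarith+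
    qed
    have e1: "((\<lambda>t. arccos (lam / sqrt (c\<^sup>2 - t\<^sup>2))) has_real_derivative
        - (s / r) * (lam * t / s ^ 3)) (at t)"
      using DERIV_chain2[OF DERIV_arccos d1] a1 q1 by (simp add: s_def[symmetric])
    have e2: "((\<lambda>t. arcsin (t / L)) has_real_derivative (L / r) * (1 / L)) (at t)"
      using DERIV_chain2[OF DERIV_arcsin DERIV_cdivide[OF DERIV_ident], of t L UNIV] a2 q2 by simp
    have e3: "((\<lambda>t. arcsin (lam * t / (L * sqrt (c\<^sup>2 - t\<^sup>2)))) has_real_derivative
        (L * s / (c * r)) * (lam * c\<^sup>2 / (L * s ^ 3))) (at t)"
      using DERIV_chain2[OF DERIV_arcsin d3] a3 q3 by (simp add: s_def[symmetric])
    have "(H has_real_derivative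
        (1 * arccos (lam / s) + - (s / r) * (lam * t / s ^ 3) * t) - lam * ((L / r) * (1 / L))
        + c * ((L * s / (c * r)) * (lam * c\<^sup>2 / (L * s ^ 3)))) (at t)"
      using DERIV_add[OF DERIV_diff[OF DERIV_mult[OF DERIV_ident e1] DERIV_cmult[OF e2, of lam]]
          DERIV_cmult[OF e3, of c]]
      unfolding H_def[abs_def] s_def[symmetric] .
    moreover have "t * (- (s / r) * (lam * t / s ^ 3)) - lam * ((L / r) * (1 / L))
        + c * ((L * s / (c * r)) * (lam * c\<^sup>2 / (L * s ^ 3))) = 0"
    proof -
      have "t * (- (s / r) * (lam * t / s ^ 3)) = - lam * t\<^sup>2 / (r * s\<^sup>2)"
        using pos(1,2) by (simp add: field_simps power2_eq_square power3_eq_cube)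
      moreover have "lam * ((L / r) * (1 / L)) = lam * s\<^sup>2 / (r * s\<^sup>2)"
        using pos(1,2) L(1) by (simp add: field_simps)
      moreover have "c * ((L * s / (c * r)) * (lam * c\<^sup>2 / (L * s ^ 3))) = lam * c\<^sup>2 / (r * s\<^sup>2)"
        using pos(1,2) L(1) c by (simp add: field_simps power2_eq_square power3_eq_cube)
      ultimately have "t * (- (s / r) * (lam * t / s ^ 3)) - lam * ((L / r) * (1 / L))
          + c * ((L * s / (c * r)) * (lam * c\<^sup>2 / (L * s ^ 3)))
          = lam * (c\<^sup>2 - t\<^sup>2 - s\<^sup>2) / (r * s\<^sup>2)"
        by (simp add: diff_divide_distrib add_divide_distrib algebra_simps)
      then show ?thesis using pos(3) by simp
    qed
    ultimately have "(H has_real_derivative arccos (lam / s)) (at t)"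
      by (simp add: algebra_simps)
    then show ?thesis by (simp add: s_def has_real_derivative_iff_has_vector_derivative)
  qed
  have "((\<lambda>t. arccos (lam / sqrt (c\<^sup>2 - t\<^sup>2))) has_integral (H L - H (- L))) {- L..L}"
    using L by (intro fundamental_theorem_of_calculus_interior cont der) auto
  moreover have "H L - H (- L) = pi * (c - lam)"
  proof -
    have "sqrt (c\<^sup>2 - L\<^sup>2) = lam" using L assms by simp
    then show ?thesis using L assms by (simp add: H_def arcsin_minus field_simps)
  qed
  ultimately show ?thesis by simp
qed

text \<open>
  Only \<open>0 < lam < c\<close> needs the integral above. At height \<open>0\<close>, where the
  quotients in the antiderivative degenerate to \<open>0 / 0\<close> at the endpoints, the fraction is \<open>1/2\<close>.
  For \<open>lam \<ge> c\<close> both sides vanish, the right one by truncation of negative numbers.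
\<close>

lemma nn_integral_circle_fraction_nonneg:
  assumes "0 \<le> lam" "0 \<le> c"
  shows "(\<integral>\<^sup>+t. ennreal (circle_fraction lam (c\<^sup>2 - t\<^sup>2)) \<partial>lborel) = ennreal (c - lam)"
proof -
  consider "c \<le> lam" | "lam = 0" "0 < c" | "0 < lam" "lam < c" using assms by linarith
  then show ?thesis
  proof cases
    case 1
    have "circle_fraction lam (c\<^sup>2 - t\<^sup>2) = 0" for t
    proof (cases "c\<^sup>2 - t\<^sup>2 > 0")
      case True
      have "sqrt (c\<^sup>2 - t\<^sup>2) \<le> lam"
        using 1 assms real_sqrt_le_mono[of "c\<^sup>2 - t\<^sup>2" "c\<^sup>2"] by simp
      then have "1 \<le> lam / sqrt (c\<^sup>2 - t\<^sup>2)" using True by (simp add: le_divide_eq)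
      then show ?thesis by (simp add: circle_fraction_def min_absorb1)
    qed (simp add: circle_fraction_def)
    then show ?thesis using 1 by (simp add: ennreal_neg)
  next
    case 2
    have "ennreal (circle_fraction lam (c\<^sup>2 - t\<^sup>2)) = ennreal (1 / 2) * indicator {- c<..<c} t" for t
    proof (cases "t \<in> {- c<..<c}")
      case True
      then have "t\<^sup>2 < c\<^sup>2" using abs_le_square_iff[of c t] by auto
      then show ?thesis using True 2 by (simp add: circle_fraction_def)
    next
      case False
      then have "c\<^sup>2 \<le> t\<^sup>2" using abs_le_square_iff[of c t] 2 by auto
      then show ?thesis using False by (simp add: circle_fraction_def)
    qed
    then have "(\<integral>\<^sup>+t. ennreal (circle_fraction lam (c\<^sup>2 - t\<^sup>2)) \<partial>lborel) = ennreal (1 / 2) * ennreal (c - (- c))"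
      using 2 by (simp add: nn_integral_cmult_indicator)
    also have "\<dots> = ennreal (1 / 2 * (c - (- c)))"
      using 2 by (intro ennreal_mult[symmetric]) auto
    finally show ?thesis using 2 by simp
  next
    case 3
    define L where "L = sqrt (c\<^sup>2 - lam\<^sup>2)"
    let ?f = "\<lambda>t. arccos (lam / sqrt (c\<^sup>2 - t\<^sup>2)) / pi"
    have "lam\<^sup>2 < c\<^sup>2" using 3 by (intro power_strict_mono) auto
    then have L: "0 < L" "L\<^sup>2 = c\<^sup>2 - lam\<^sup>2" by (auto simp: L_def)
    have in_L: "lam\<^sup>2 \<le> c\<^sup>2 - t\<^sup>2" "lam / sqrt (c\<^sup>2 - t\<^sup>2) \<le> 1" "0 < c\<^sup>2 - t\<^sup>2"
      "0 \<le> lam / sqrt (c\<^sup>2 - t\<^sup>2)" if "t \<in> {- L..L}" for t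
    proof -
      have "t\<^sup>2 \<le> L\<^sup>2" using that abs_le_square_iff[of t L] by auto
      then show *: "lam\<^sup>2 \<le> c\<^sup>2 - t\<^sup>2" using L by simp
      have "lam\<^sup>2 > 0" using 3 by simp
      with * show pos: "0 < c\<^sup>2 - t\<^sup>2" by linarith
      have "lam \<le> sqrt (c\<^sup>2 - t\<^sup>2)" using * by (rule real_le_rsqrt)
      with pos show "lam / sqrt (c\<^sup>2 - t\<^sup>2) \<le> 1" by simp
      show "0 \<le> lam / sqrt (c\<^sup>2 - t\<^sup>2)" using 3 pos by simp
    qed
    have "((\<lambda>t. ?f t) has_integral (c - lam)) {- L..L}"
      using has_integral_mult_right[OF has_integral_arccos_slice[OF 3], of "1 / pi"]
      by (simp add: L_def)
    moreover have "0 \<le> ?f t" if "t \<in> {- L..L}" for t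
      using in_L[OF that] by (intro divide_nonneg_nonneg arccos_lbound) auto
    ultimately have "(\<integral>\<^sup>+t. ennreal (indicator {- L..L} t * ?f t) \<partial>lborel) = ennreal (c - lam)"
      by (intro nn_integral_has_integral_lebesgue) auto
    moreover have "indicator {- L..L} t * ?f t = circle_fraction lam (c\<^sup>2 - t\<^sup>2)" for t
    proof (cases "t \<in> {- L..L}")
      case True
      then show ?thesis using in_L[OF True] by (simp add: circle_fraction_def)
    next
      case False
      then have "L\<^sup>2 < t\<^sup>2" using abs_le_square_iff[of t L] L by auto
      then have small: "c\<^sup>2 - t\<^sup>2 < lam\<^sup>2" using L by simp
      have "circle_fraction lam (c\<^sup>2 - t\<^sup>2) = 0"
      proof (cases "c\<^sup>2 - t\<^sup>2 > 0")
        case True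
        have "sqrt (c\<^sup>2 - t\<^sup>2) \<le> lam" using small 3 by (intro real_le_lsqrt) auto
        then have "1 \<le> lam / sqrt (c\<^sup>2 - t\<^sup>2)" using True by (simp add: le_divide_eq)
        then show ?thesis by (simp add: circle_fraction_def min_absorb1)
      qed (simp add: circle_fraction_def)
      then show ?thesis using False by simp
    qed
    ultimately show ?thesis by simp
  qed
qed

text \<open>
  The property that determines the density: its integral along a line is the length of the part of
  the line in the cap. Negative heights reduce to positive ones because the fractions for \<open>lam\<close> and
  \<open>- lam\<close> add up to \<open>1\<close>.
\<close>

lemma nn_integral_circle_fraction:
  "(\<integral>\<^sup>+t. ennreal (circle_fraction lam (w - t\<^sup>2)) \<partial>lborel) = emeasure lborel {t. lam < t \<and> t\<^sup>2 < w}"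
proof (cases "w \<le> 0")
  case True
  have "circle_fraction lam (w - t\<^sup>2) = 0" for t
  proof -
    have "\<not> 0 < w - t\<^sup>2" using True zero_le_power2[of t] by linarith
    then show ?thesis by (simp add: circle_fraction_def)
  qed
  moreover have "\<not> t\<^sup>2 < w" for t
    using True zero_le_power2[of t] by linarith
  ultimately show ?thesis by simp
next
  case False
  define c where "c = sqrt w"
  have c: "0 < c" "w = c\<^sup>2" using False by (auto simp: c_def)
  have sq: "t\<^sup>2 < c\<^sup>2 \<longleftrightarrow> - c < t \<and> t < c" for t
    using abs_le_square_iff[of c t] c by auto
  have interval: "{t. lam < t \<and> t\<^sup>2 < w} = {max lam (- c)<..<c}"
    by (auto simp: c sq)
  have meas: "emeasure lborel {t. lam < t \<and> t\<^sup>2 < w} = ennreal (c - max lam (- c))"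
  proof (cases "lam \<le> c")
    case True
    then show ?thesis unfolding interval using c(1) by (simp add: max_def)
  next
    case False
    then have "{max lam (- c)<..<c} = {}" by auto
    then show ?thesis unfolding interval using False by (simp add: ennreal_neg)
  qed
  show ?thesis
  proof (cases "0 \<le> lam")
    case True
    then show ?thesis using c(1) unfolding meas unfolding c(2)
      by (simp add: nn_integral_circle_fraction_nonneg max_def)
  next
    case False
    let ?F = "\<lambda>lam t. ennreal (circle_fraction lam (c\<^sup>2 - t\<^sup>2))"
    have "?F (- lam) t + ?F lam t = indicator {- c<..<c} t" for t
    proof (cases "t\<^sup>2 < c\<^sup>2")
      case True
      then have "circle_fraction (- lam) (c\<^sup>2 - t\<^sup>2) + circle_fraction lam (c\<^sup>2 - t\<^sup>2) = 1"
        using circle_fraction_uminus[of "c\<^sup>2 - t\<^sup>2" lam] by simp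
      then have "?F (- lam) t + ?F lam t = ennreal 1"
        by (metis circle_fraction_nonneg ennreal_plus)
      then show ?thesis using True sq by simp
    next
      case False
      then show ?thesis using sq by (auto simp: circle_fraction_def)
    qed
    then have "(\<integral>\<^sup>+t. ?F (- lam) t + ?F lam t \<partial>lborel) = ennreal (2 * c)"
      using c by simp
    then have "ennreal (c + lam) + (\<integral>\<^sup>+t. ?F lam t \<partial>lborel) = ennreal (2 * c)"
      using False c by (simp add: nn_integral_add nn_integral_circle_fraction_nonneg)
    also have "\<dots> = ennreal (c + lam) + ennreal (c - max lam (- c))"
      using False c by (cases "0 \<le> c + lam") (simp_all add: ennreal_neg max_def flip: ennreal_plus)
    finally show ?thesis
      unfolding meas unfolding c(2) by (simp add: ennreal_add_left_cancel)
  qed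
qed

text \<open>
  The one-dimensional comparison. Either \<open>T\<close> contains all heights above \<open>lam\<close> and the right-hand
  side is the integral over the whole line, or \<open>T\<close> lies above \<open>lam\<close> and the integrand is at most
  the indicator function.
\<close>

lemma nn_integral_circle_fraction_upward_closed:
  assumes [measurable]: "T \<in> sets borel" and up: "\<And>s t. s \<in> T \<Longrightarrow> s \<le> t \<Longrightarrow> t \<in> T"
  shows "(\<integral>\<^sup>+t. indicator T t * ennreal (circle_fraction lam (w - t\<^sup>2)) \<partial>lborel)
    \<le> emeasure lborel (T \<inter> {t. lam < t \<and> t\<^sup>2 < w})"
proof (cases "{lam<..} \<subseteq> T")
  case True
  then have "T \<inter> {t. lam < t \<and> t\<^sup>2 < w} = {t. lam < t \<and> t\<^sup>2 < w}" by auto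
  moreover have "(\<integral>\<^sup>+t. indicator T t * ennreal (circle_fraction lam (w - t\<^sup>2)) \<partial>lborel)
      \<le> (\<integral>\<^sup>+t. ennreal (circle_fraction lam (w - t\<^sup>2)) \<partial>lborel)"
    by (intro nn_integral_mono) (simp split: split_indicator)
  ultimately show ?thesis by (simp add: nn_integral_circle_fraction)
next
  case False
  then have T: "lam < t" if "t \<in> T" for t
    using up[OF that] by force
  have "(\<integral>\<^sup>+t. indicator T t * ennreal (circle_fraction lam (w - t\<^sup>2)) \<partial>lborel)
      \<le> (\<integral>\<^sup>+t. indicator (T \<inter> {t. lam < t \<and> t\<^sup>2 < w}) t \<partial>lborel)"
  proof (intro nn_integral_mono)
    fix t
    show "indicator T t * ennreal (circle_fraction lam (w - t\<^sup>2))
        \<le> indicator (T \<inter> {t. lam < t \<and> t\<^sup>2 < w}) t"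
    proof (cases "t\<^sup>2 < w")
      case True
      then show ?thesis using T[of t] circle_fraction_le_1[of lam "w - t\<^sup>2"]
        by (auto split: split_indicator)
    qed (simp add: circle_fraction_def)
  qed
  then show ?thesis by simp
qed

section \<open>Integration along parallel lines\<close>

text \<open>
  A substitute for Fubini's theorem in coordinates adapted to \<open>\<nu>\<close>. The inner integral is constant
  along lines in direction \<open>\<nu>\<close>, so the outer one has to be restricted to a slab of width \<open>1\<close>. The
  identity follows from translation invariance and from Tonelli's theorem for pairs \<open>(\<xi>, t)\<close>: the
  translates of the slab by \<open>t\<close> cover each point for a set of \<open>t\<close> of length \<open>1\<close>.
\<close>

lemma nn_integral_lines:
  fixes g :: "'a::euclidean_space \<Rightarrow> ennreal" and \<nu> :: 'a
  assumes [measurable]: "g \<in> borel_measurable borel" and \<nu>: "norm \<nu> = 1"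
  shows "(\<integral>\<^sup>+\<xi>. g \<xi> \<partial>lborel) =
    (\<integral>\<^sup>+\<xi>. indicator {0..1} (\<xi> \<bullet> \<nu>) * (\<integral>\<^sup>+t. g (\<xi> + t *\<^sub>R \<nu>) \<partial>lborel) \<partial>lborel)"
proof -
  have \<nu>2: "\<nu> \<bullet> \<nu> = 1" using \<nu> by (simp add: dot_square_norm)
  let ?k = "indicator {0..1::real} :: real \<Rightarrow> ennreal"
  have "(\<integral>\<^sup>+\<xi>. ?k (\<xi> \<bullet> \<nu>) * (\<integral>\<^sup>+t. g (\<xi> + t *\<^sub>R \<nu>) \<partial>lborel) \<partial>lborel) =
      (\<integral>\<^sup>+\<xi>. (\<integral>\<^sup>+t. ?k (\<xi> \<bullet> \<nu>) * g (\<xi> + t *\<^sub>R \<nu>) \<partial>lborel) \<partial>lborel)"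
    by (intro nn_integral_cong nn_integral_cmult[symmetric]) measurable
  also have "\<dots> = (\<integral>\<^sup>+t. (\<integral>\<^sup>+\<xi>. ?k (\<xi> \<bullet> \<nu>) * g (\<xi> + t *\<^sub>R \<nu>) \<partial>lborel) \<partial>lborel)"
    by (rule lborel_pair.Fubini'[symmetric]) measurable
  also have "\<dots> = (\<integral>\<^sup>+t. (\<integral>\<^sup>+\<xi>. ?k (\<xi> \<bullet> \<nu> - t) * g \<xi> \<partial>lborel) \<partial>lborel)"
  proof (rule nn_integral_cong)
    fix t :: real
    have "(\<integral>\<^sup>+\<xi>. ?k (\<xi> \<bullet> \<nu> - t) * g \<xi> \<partial>lborel)
        = (\<integral>\<^sup>+\<xi>. ?k (\<xi> \<bullet> \<nu> - t) * g \<xi> \<partial>distr lborel borel ((+) (t *\<^sub>R \<nu>)))"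
      by (simp add: lborel_distr_plus)
    also have "\<dots> = (\<integral>\<^sup>+\<xi>. ?k ((t *\<^sub>R \<nu> + \<xi>) \<bullet> \<nu> - t) * g (t *\<^sub>R \<nu> + \<xi>) \<partial>lborel)"
      by (rule nn_integral_distr) measurable
    finally show "(\<integral>\<^sup>+\<xi>. ?k (\<xi> \<bullet> \<nu>) * g (\<xi> + t *\<^sub>R \<nu>) \<partial>lborel)
        = (\<integral>\<^sup>+\<xi>. ?k (\<xi> \<bullet> \<nu> - t) * g \<xi> \<partial>lborel)"
      by (simp add: inner_add_left \<nu>2 add.commute)
  qed
  also have "\<dots> = (\<integral>\<^sup>+\<xi>. (\<integral>\<^sup>+t. ?k (\<xi> \<bullet> \<nu> - t) * g \<xi> \<partial>lborel) \<partial>lborel)"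
    by (rule lborel_pair.Fubini') measurable
  also have "\<dots> = (\<integral>\<^sup>+\<xi>. g \<xi> \<partial>lborel)"
  proof (rule nn_integral_cong)
    fix \<xi> :: 'a
    have "(\<integral>\<^sup>+t. ?k (\<xi> \<bullet> \<nu> - t) \<partial>lborel) = (\<integral>\<^sup>+t. ?k t \<partial>lborel)"
      using nn_integral_real_affine[of ?k "-1" "\<xi> \<bullet> \<nu>"] by simp
    then show "(\<integral>\<^sup>+t. ?k (\<xi> \<bullet> \<nu> - t) * g \<xi> \<partial>lborel) = g \<xi>"
      by (simp add: nn_integral_multc)
  qed
  finally show ?thesis by simp
qed

lemma nn_integral_mono_lines:
  fixes g h :: "'a::euclidean_space \<Rightarrow> ennreal"
  assumes [measurable]: "g \<in> borel_measurable borel" "h \<in> borel_measurable borel"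
    and \<nu>: "norm \<nu> = 1"
    and le: "\<And>p. p \<bullet> \<nu> = 0 \<Longrightarrow>
      (\<integral>\<^sup>+t. g (p + t *\<^sub>R \<nu>) \<partial>lborel) \<le> (\<integral>\<^sup>+t. h (p + t *\<^sub>R \<nu>) \<partial>lborel)"
  shows "(\<integral>\<^sup>+\<xi>. g \<xi> \<partial>lborel) \<le> (\<integral>\<^sup>+\<xi>. h \<xi> \<partial>lborel)"
proof -
  have \<nu>2: "\<nu> \<bullet> \<nu> = 1" using \<nu> by (simp add: dot_square_norm)
  have "(\<integral>\<^sup>+t. g (\<xi> + t *\<^sub>R \<nu>) \<partial>lborel) \<le> (\<integral>\<^sup>+t. h (\<xi> + t *\<^sub>R \<nu>) \<partial>lborel)" for \<xi>
  proof -
    (* Move the base point of the line to its foot on the hyperplane orthogonal to the direction. *)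
    define p where "p = \<xi> - (\<xi> \<bullet> \<nu>) *\<^sub>R \<nu>"
    have eq: "(\<integral>\<^sup>+t. f (\<xi> + t *\<^sub>R \<nu>) \<partial>lborel) = (\<integral>\<^sup>+t. f (p + t *\<^sub>R \<nu>) \<partial>lborel)"
      if [measurable]: "f \<in> borel_measurable borel" for f :: "'a \<Rightarrow> ennreal"
      using nn_integral_real_affine[of "\<lambda>t. f (p + t *\<^sub>R \<nu>)" 1 "\<xi> \<bullet> \<nu>"]
      by (simp add: p_def algebra_simps)
    have "p \<bullet> \<nu> = 0" by (simp add: p_def inner_diff_left \<nu>2)
    from le[OF this] show ?thesis by (simp add: eq)
  qed
  then show ?thesis
    unfolding nn_integral_lines[OF assms(1) \<nu>] nn_integral_lines[OF assms(2) \<nu>]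
    by (intro nn_integral_mono[OF mult_left_mono]) auto
qed

section \<open>The rotation invariant density and caps\<close>

definition cap_density :: "real \<Rightarrow> 'a::euclidean_space \<Rightarrow> real" where
  "cap_density lam q = circle_fraction lam (1 - (norm q)\<^sup>2)"

lemma cap_density_measurable [measurable]: "cap_density lam \<in> borel_measurable borel"
  unfolding cap_density_def[abs_def] by measurable

lemma cap_borel [measurable]: "cap e lam \<in> sets borel"
proof -
  have "cap e lam = ball 0 1 \<inter> {x. lam < x \<bullet> e}" by (auto simp: cap_def)
  moreover have "open {x. lam < x \<bullet> e}"
    by (intro open_Collect_less continuous_intros)
  ultimately show ?thesis by (auto intro: borel_open)
qed

lemma norm_line_squared:
  assumes "norm \<nu> = 1" "p \<bullet> \<nu> = 0"
  shows "(norm (p + t *\<^sub>R \<nu>))\<^sup>2 = (norm p)\<^sup>2 + t\<^sup>2"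
proof -
  have "\<nu> \<bullet> \<nu> = 1" using assms(1) by (simp add: dot_square_norm)
  then show ?thesis
    unfolding power2_norm_eq_inner using assms(2)
    by (simp add: inner_add_left inner_add_right inner_commute power2_eq_square)
qed

lemma line_in_cap_iff:
  assumes "norm \<nu> = 1" "p \<bullet> \<nu> = 0"
  shows "p + t *\<^sub>R \<nu> \<in> cap \<nu> lam \<longleftrightarrow> lam < t \<and> t\<^sup>2 < 1 - (norm p)\<^sup>2"
proof -
  have "p + t *\<^sub>R \<nu> \<in> ball 0 1 \<longleftrightarrow> (norm (p + t *\<^sub>R \<nu>))\<^sup>2 < 1"
    by (simp add: abs_square_less_1)
  moreover have "(p + t *\<^sub>R \<nu>) \<bullet> \<nu> = t"
    using assms by (simp add: inner_add_left dot_square_norm)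
  ultimately show ?thesis
    unfolding cap_def norm_line_squared[OF assms] by auto
qed

lemma cap_density_line:
  assumes "norm \<nu> = 1" "p \<bullet> \<nu> = 0"
  shows "cap_density lam (p + t *\<^sub>R \<nu>) = circle_fraction lam ((1 - (norm p)\<^sup>2) - t\<^sup>2)"
  by (simp add: cap_density_def norm_line_squared[OF assms] diff_diff_eq)

text \<open>
  On every line in direction \<open>e\<close> the cap and the density have the same mass.
\<close>

lemma emeasure_cap_le_density:
  fixes e :: "'a::euclidean_space"
  assumes e: "norm e = 1"
  shows "emeasure lborel (cap e lam) \<le> (\<integral>\<^sup>+\<xi>. ennreal (cap_density lam (\<xi>::'a)) \<partial>lborel)"
proof -
  have "(\<integral>\<^sup>+\<xi>. indicator (cap e lam) \<xi> \<partial>lborel) \<le> (\<integral>\<^sup>+\<xi>. ennreal (cap_density lam (\<xi>::'a)) \<partial>lborel)"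
  proof (rule nn_integral_mono_lines[OF _ _ e])
    fix p :: 'a assume p: "p \<bullet> e = 0"
    have "(\<integral>\<^sup>+t. indicator (cap e lam) (p + t *\<^sub>R e) \<partial>lborel)
        = (\<integral>\<^sup>+t. indicator {t. lam < t \<and> t\<^sup>2 < 1 - (norm p)\<^sup>2} t \<partial>lborel)"
      by (simp add: indicator_def line_in_cap_iff[OF e p])
    also have "\<dots> = emeasure lborel {t. lam < t \<and> t\<^sup>2 < 1 - (norm p)\<^sup>2}"
      by (rule nn_integral_indicator) measurable
    also have "\<dots> = (\<integral>\<^sup>+t. ennreal (cap_density lam (p + t *\<^sub>R e)) \<partial>lborel)"
      by (simp add: cap_density_line[OF e p] nn_integral_circle_fraction)
    finally show "(\<integral>\<^sup>+t. indicator (cap e lam) (p + t *\<^sub>R e) \<partial>lborel)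
        \<le> (\<integral>\<^sup>+t. ennreal (cap_density lam (p + t *\<^sub>R e)) \<partial>lborel)"
      by simp
  qed measurable
  then show ?thesis by simp
qed

text \<open>
  The comparison of a cell with the cap in its own direction, by integrating the one-dimensional
  comparison over the lines in direction \<open>\<nu>\<close>, which meet \<open>J\<close> in upward closed sets.
\<close>

lemma density_cell_le_cap:
  fixes \<nu> :: "'a::euclidean_space"
  assumes J [measurable]: "J \<in> sets borel" and \<nu>: "norm \<nu> = 1"
    and up: "\<And>\<xi> t. \<xi> \<in> J \<Longrightarrow> 0 \<le> t \<Longrightarrow> \<xi> + t *\<^sub>R \<nu> \<in> J"
  shows "(\<integral>\<^sup>+\<xi>. indicator J \<xi> * ennreal (cap_density lam \<xi>) \<partial>lborel)
    \<le> emeasure lborel (J \<inter> cap \<nu> lam)"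
proof -
  have "(\<integral>\<^sup>+\<xi>. indicator J \<xi> * ennreal (cap_density lam \<xi>) \<partial>lborel)
      \<le> (\<integral>\<^sup>+\<xi>. indicator (J \<inter> cap \<nu> lam) \<xi> \<partial>lborel)"
  proof (rule nn_integral_mono_lines[OF _ _ \<nu>])
    fix p :: 'a assume p: "p \<bullet> \<nu> = 0"
    define T where "T = {t. p + t *\<^sub>R \<nu> \<in> J}"
    have T [measurable]: "T \<in> sets borel"
    proof -
      have "(\<lambda>t. p + t *\<^sub>R \<nu>) -` J \<inter> space borel \<in> sets borel"
        by (rule measurable_sets[OF _ J]) measurable
      then show ?thesis by (simp add: T_def vimage_def)
    qed
    have T_up: "t \<in> T" if "s \<in> T" "s \<le> t" for s t
      using up[of "p + s *\<^sub>R \<nu>" "t - s"] that by (simp add: T_def algebra_simps)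
    have "(\<integral>\<^sup>+t. indicator J (p + t *\<^sub>R \<nu>) * ennreal (cap_density lam (p + t *\<^sub>R \<nu>)) \<partial>lborel)
        = (\<integral>\<^sup>+t. indicator T t * ennreal (circle_fraction lam ((1 - (norm p)\<^sup>2) - t\<^sup>2)) \<partial>lborel)"
      by (simp add: cap_density_line[OF \<nu> p] T_def indicator_def)
    also have "\<dots> \<le> emeasure lborel (T \<inter> {t. lam < t \<and> t\<^sup>2 < 1 - (norm p)\<^sup>2})"
      by (rule nn_integral_circle_fraction_upward_closed[OF T T_up])
    also have "\<dots> = (\<integral>\<^sup>+t. indicator (T \<inter> {t. lam < t \<and> t\<^sup>2 < 1 - (norm p)\<^sup>2}) t \<partial>lborel)"
      by (rule nn_integral_indicator[symmetric]) measurable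
    also have "\<dots> = (\<integral>\<^sup>+t. indicator (J \<inter> cap \<nu> lam) (p + t *\<^sub>R \<nu>) \<partial>lborel)"
      by (simp add: indicator_def T_def line_in_cap_iff[OF \<nu> p])
    finally show "(\<integral>\<^sup>+t. indicator J (p + t *\<^sub>R \<nu>) * ennreal (cap_density lam (p + t *\<^sub>R \<nu>)) \<partial>lborel)
        \<le> (\<integral>\<^sup>+t. indicator (J \<inter> cap \<nu> lam) (p + t *\<^sub>R \<nu>) \<partial>lborel)" .
  qed measurable
  then show ?thesis by simp
qed

section \<open>Subdifferentials on finite sets\<close>

lemma closed_subdifferential: "closed (subdifferential K v x)"
proof -
  have "subdifferential K v x = (\<Inter>y\<in>K. {\<xi>. \<xi> \<bullet> (y - x) \<le> v y - v x})"
    by (auto simp: subdifferential_def)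
  also have "closed \<dots>"
    by (intro closed_INT ballI closed_Collect_le continuous_intros)
  finally show ?thesis .
qed

lemma subdifferential_borel [measurable]: "subdifferential K v x \<in> sets borel"
  by (intro borel_closed closed_subdifferential)

text \<open>The point \<open>x\<close> is a minimizer of \<open>v y - \<xi> \<bullet> y\<close> over \<open>K\<close>.\<close>

lemma subdifferential_nonempty_fibre:
  assumes "finite K" "K \<noteq> {}"
  shows "\<exists>x\<in>K. \<xi> \<in> subdifferential K v x"
proof -
  obtain x where "x \<in> K" "\<And>y. y \<in> K \<Longrightarrow> v x - \<xi> \<bullet> x \<le> v y - \<xi> \<bullet> y"
    using ex_min_if_finite[of "(\<lambda>y. v y - \<xi> \<bullet> y) ` K"] assms by (auto simp: not_less)
  then show ?thesis
    by (intro bexI[of _ x]) (auto simp: subdifferential_def inner_diff_right algebra_simps)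
qed

lemma subdifferential_translate:
  assumes "\<xi> \<in> subdifferential K v x" "0 \<le> t" "\<And>y. y \<in> K \<Longrightarrow> \<nu> \<bullet> (y - x) \<le> 0"
  shows "\<xi> + t *\<^sub>R \<nu> \<in> subdifferential K v x"
  unfolding subdifferential_def
proof (intro CollectI ballI)
  fix y assume y: "y \<in> K"
  have "t * (\<nu> \<bullet> (y - x)) \<le> 0" using assms(2) assms(3)[OF y] by (simp add: mult_nonneg_nonpos)
  then show "(\<xi> + t *\<^sub>R \<nu>) \<bullet> (y - x) \<le> v y - v x"
    using assms(1) y by (auto simp: subdifferential_def inner_add_left intro: order_trans[rotated])
qed

text \<open>
  Translating in direction \<open>\<nu>\<close> favours \<open>x\<close> over \<open>y\<close>, so if \<open>y\<close> still ties with the minimizer \<open>x\<close>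
  after the translation, it tied before. Hence breaking ties preserves the invariance of the cell
  of \<open>x\<close> under these translations.
\<close>

lemma subdifferential_translate_back:
  assumes "\<xi> + t *\<^sub>R \<nu> \<in> subdifferential K v y" "0 \<le> t" "\<nu> \<bullet> (y - x) \<le> 0"
    and "\<xi> \<in> subdifferential K v x" "x \<in> K"
  shows "\<xi> \<in> subdifferential K v y"
  unfolding subdifferential_def
proof (intro CollectI ballI)
  fix z assume "z \<in> K"
  then have "\<xi> \<bullet> (z - x) \<le> v z - v x" using assms(4) by (simp add: subdifferential_def)
  moreover have "(\<xi> + t *\<^sub>R \<nu>) \<bullet> (x - y) \<le> v x - v y"
    using assms(1,5) by (simp add: subdifferential_def)
  moreover have "t * (\<nu> \<bullet> (y - x)) \<le> 0" using assms(2,3) by (simp add: mult_nonneg_nonpos)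
  ultimately show "\<xi> \<bullet> (z - y) \<le> v z - v y"
    by (simp add: inner_add_left inner_diff_right algebra_simps)
qed

text \<open>
  Here \<open>n x\<close> is any unit vector that supports \<open>K\<close> at \<open>x\<close>. The subdifferentials overlap where two
  points tie; assigning each \<open>\<xi>\<close> to the first of its minimizers in an enumeration \<open>r\<close> of \<open>K\<close>
  produces disjoint cells, so that the volumes in the caps can be added.
\<close>

lemma emeasure_cap_le_subgradients:
  fixes K :: "'a::euclidean_space set" and n :: "'a \<Rightarrow> 'a" and e :: 'a
  assumes K: "finite K" "K \<noteq> {}" and e: "norm e = 1"
    and n: "\<And>x. x \<in> K \<Longrightarrow> norm (n x) = 1"
    and supp: "\<And>x y. x \<in> K \<Longrightarrow> y \<in> K \<Longrightarrow> n x \<bullet> (y - x) \<le> 0"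
  shows "emeasure lborel (cap e lam)
    \<le> emeasure lborel (\<Union>x\<in>K. subdifferential K v x \<inter> cap (n x) lam)"
proof -
  obtain r :: "'a \<Rightarrow> nat" where r: "inj_on r K"
    using finite_imp_inj_to_nat_seg[OF K(1)] by blast
  define J where "J x = subdifferential K v x - (\<Union>y\<in>{y\<in>K. r y < r x}. subdifferential K v y)" for x
  have J_borel [measurable]: "J x \<in> sets borel" for x
    unfolding J_def using K(1) by (intro sets.Diff sets.finite_UN) auto
  have J_up: "\<xi> + t *\<^sub>R n x \<in> J x" if "x \<in> K" "\<xi> \<in> J x" "0 \<le> t" for x \<xi> t
    using that subdifferential_translate[of \<xi> K v x t "n x"] supp
      subdifferential_translate_back[of \<xi> t "n x" K v _ x]
    unfolding J_def by blast
  have J_cover: "\<exists>x\<in>K. \<xi> \<in> J x" for \<xi>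
  proof -
    obtain x where "x \<in> K \<and> \<xi> \<in> subdifferential K v x"
      using subdifferential_nonempty_fibre[OF K] by blast
    from ex_has_least_nat[of "\<lambda>x. x \<in> K \<and> \<xi> \<in> subdifferential K v x", OF this, of r]
    obtain z where "z \<in> K" "\<xi> \<in> subdifferential K v z"
      "\<And>y. y \<in> K \<Longrightarrow> \<xi> \<in> subdifferential K v y \<Longrightarrow> r z \<le> r y" by blast
    then show ?thesis by (intro bexI[of _ z]) (force simp: J_def)+
  qed
  have J_disj: "disjoint_family_on J K"
    unfolding disjoint_family_on_def
  proof (intro ballI impI)
    fix x y assume "x \<in> K" "y \<in> K" "x \<noteq> y"
    then have "r x < r y \<or> r y < r x" using r by (metis inj_onD linorder_neqE_nat)
    then show "J x \<inter> J y = {}" using \<open>x \<in> K\<close> \<open>y \<in> K\<close> by (auto simp: J_def)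
  qed
  have "emeasure lborel (cap e lam) \<le> (\<integral>\<^sup>+\<xi>. ennreal (cap_density lam (\<xi>::'a)) \<partial>lborel)"
    by (rule emeasure_cap_le_density[OF e])
  also have "\<dots> \<le> (\<integral>\<^sup>+\<xi>. (\<Sum>x\<in>K. indicator (J x) \<xi> * ennreal (cap_density lam \<xi>)) \<partial>lborel)"
  proof (rule nn_integral_mono)
    fix \<xi> :: 'a
    obtain x where x: "x \<in> K" "\<xi> \<in> J x" using J_cover by blast
    then show "ennreal (cap_density lam \<xi>)
        \<le> (\<Sum>x\<in>K. indicator (J x) \<xi> * ennreal (cap_density lam \<xi>))"
      using member_le_sum[OF x(1), of "\<lambda>x. indicator (J x) \<xi> * ennreal (cap_density lam \<xi>)"] K(1)
      by simp
  qed
  also have "\<dots> = (\<Sum>x\<in>K. \<integral>\<^sup>+\<xi>. indicator (J x) \<xi> * ennreal (cap_density lam \<xi>) \<partial>lborel)"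
    by (rule nn_integral_sum) measurable
  also have "\<dots> \<le> (\<Sum>x\<in>K. emeasure lborel (J x \<inter> cap (n x) lam))"
    by (intro sum_mono density_cell_le_cap n J_up) auto
  also have "\<dots> = emeasure lborel (\<Union>x\<in>K. J x \<inter> cap (n x) lam)"
    using J_disj K(1)
    by (intro sum_emeasure) (auto simp: disjoint_family_on_def)
  also have "\<dots> \<le> emeasure lborel (\<Union>x\<in>K. subdifferential K v x \<inter> cap (n x) lam)"
    using K(1)
    by (intro emeasure_mono sets.finite_UN) (auto simp: J_def)
  finally show ?thesis .
qed

section \<open>Convex sets with \<open>C\<^sup>1\<close> boundary\<close>

text \<open>
  If the normal made an acute angle with \<open>y - x\<close>, then the defining function \<open>z \<bullet> u - g z\<close>, which
  vanishes at \<open>x\<close>, would be positive at points of the segment from \<open>x\<close> to \<open>y\<close> close to \<open>x\<close>; these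
  points belong to \<open>C\<close> by convexity.
\<close>

lemma outer_unit_normal_supports:
  assumes C: "closed C" "convex C" "C1_boundary C" and x: "x \<in> frontier C"
  shows "norm (outer_unit_normal C x) = 1"
    and "y \<in> C \<Longrightarrow> outer_unit_normal C x \<bullet> (y - x) \<le> 0"
proof -
  obtain u g G r where gr: "C1_graph_at C x u g G r"
    using C(3) x by (auto simp: C1_boundary_def)
  note nz = C1_graph_gradient_nonzero[OF gr]
  note eq = outer_unit_normal_eq[OF gr x]
  show "norm (outer_unit_normal C x) = 1" using nz by (simp add: eq norm_sgn)
  have xC: "x \<in> C" using x C(1) by (simp add: frontier_def)
  assume y: "y \<in> C"
  have "(u - G x) \<bullet> (y - x) \<le> 0"
  proof (rule ccontr)
    assume "\<not> ?thesis"
    then have pos: "0 < (u - G x) \<bullet> (y - x)" by simp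
    then have ne: "norm (y - x) > 0" by auto
    let ?f = "\<lambda>t. (x + t *\<^sub>R (y - x)) \<bullet> u - g (x + t *\<^sub>R (y - x))"
    have "?f 0 = 0" using C1_graph_frontier_eq[OF gr x] by simp
    then obtain d where d: "d > 0" "\<And>t. 0 < t \<Longrightarrow> t < d \<Longrightarrow> 0 < ?f t"
      using DERIV_pos_inc_right[OF C1_graph_derivative[OF gr] pos] by auto
    have r: "r > 0" and below: "C \<inter> ball x r = {z \<in> ball x r. z \<bullet> u \<le> g z}"
      using gr by (simp_all add: C1_graph_at_def)
    define s where "s = min (min d (r / norm (y - x))) 1"
    define t where "t = s / 2"
    have "0 < r / norm (y - x)" using r ne by simp
    then have "0 < s" "s \<le> d" "s \<le> r / norm (y - x)" "s \<le> 1"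
      using d(1) by (auto simp: s_def)
    then have t: "0 < t" "t < d" "t < r / norm (y - x)" "t \<le> 1"
      unfolding t_def by linarith+
    have "(1 - t) *\<^sub>R x + t *\<^sub>R y \<in> C"
      using C(2) xC y t by (intro convexD) auto
    then have "x + t *\<^sub>R (y - x) \<in> C" by (simp add: algebra_simps)
    moreover have "x + t *\<^sub>R (y - x) \<in> ball x r"
      using t(1,3) ne by (simp add: dist_norm pos_less_divide_eq)
    ultimately have "x + t *\<^sub>R (y - x) \<in> {z \<in> ball x r. z \<bullet> u \<le> g z}"
      using below by blast
    then have "?f t \<le> 0" by simp
    with d(2)[OF t(1,2)] show False by simp
  qed
  then show "outer_unit_normal C x \<bullet> (y - x) \<le> 0"
    by (simp add: eq sgn_div_norm mult_nonneg_nonpos)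
qed

text \<open>
  Inside the unit ball, the subgradients at \<open>x\<close> whose component along the outer normal exceeds
  \<open>lam\<close> are those in the cap of height \<open>lam\<close> around that normal.
\<close>

lemma ABP_property_convex_C1:
  fixes C :: "'a::euclidean_space set"
  assumes C: "closed C" "convex C" "C1_boundary C" and e: "norm e = 1"
  shows "ABP_property e lam C"
  unfolding ABP_property_def
proof (intro allI impI, elim conjE)
  fix K :: "'a set" and v
  assume K: "finite K" "K \<noteq> {}" "K \<subseteq> frontier C"
  let ?n = "outer_unit_normal C"
  let ?B = "\<Union>x\<in>K. subdifferential K v x \<inter> cap (?n x) lam"
  have B: "restricted_subgradients C K v lam \<inter> ball 0 1 = ?B"
    by (auto simp: restricted_subgradients_def cap_def)
  have KC: "K \<subseteq> C" using K(3) C(1) by (auto simp: frontier_def)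
  have borel: "cap e lam \<in> sets borel" "?B \<in> sets borel"
    using K(1) by (auto intro!: sets.finite_UN)
  have "emeasure lborel (cap e lam) \<le> emeasure lborel ?B"
    using K(3) KC by (intro emeasure_cap_le_subgradients K e outer_unit_normal_supports[OF C]) auto
  moreover have "emeasure lborel ?B < \<infinity>"
  proof -
    have "bounded ?B" by (rule bounded_subset[OF bounded_ball[of 0 1]]) (auto simp: cap_def)
    then show ?thesis by (rule emeasure_bounded_finite)
  qed
  ultimately have "measure lborel (cap e lam) \<le> measure lborel ?B"
    unfolding measure_def by (intro enn2real_mono) auto
  then show "measure lebesgue (cap e lam)
      \<le> measure lebesgue (restricted_subgradients C K v lam \<inter> ball 0 1)"
    using borel unfolding B by (simp add: measure_completion)
qed

text \<open>
  The assumption on the adjoint says that the adjoint embeds the target of \<open>f\<close> isometrically as a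
  subspace, so that \<open>f\<close> is an orthogonal projection onto this subspace. Then \<open>g \<circ> f\<close> has the
  gradient \<open>adjoint f (G (f x))\<close>, unit directions are lifted to unit directions by the adjoint, and
  the same radius works since \<open>f\<close> does not increase distances.
\<close>

lemma C1_boundary_vimage:
  fixes f :: "'a::euclidean_space \<Rightarrow> 'b::euclidean_space"
  assumes f: "linear f" and sect: "\<And>y. f (adjoint f y) = y"
    and S: "closed S" "C1_boundary S"
  shows "C1_boundary (f -` S)"
  unfolding C1_boundary_def
proof
  fix p assume p: "p \<in> frontier (f -` S)"
  let ?a = "adjoint f"
  have bl: "bounded_linear f" and a: "linear ?a" "bounded_linear ?a"
    using f adjoint_linear[OF f] by (auto simp: linear_conv_bounded_linear)
  have adj: "x \<bullet> ?a y = f x \<bullet> y" for x y by (rule adjoint_works[OF f])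
  have cont: "continuous_on UNIV f" "continuous_on UNIV ?a"
    using bl a by (auto intro: linear_continuous_on)
  have norm_a: "norm (?a y) = norm y" for y
    by (simp add: norm_eq_sqrt_inner adj sect)
  have norm_f: "norm (f x) \<le> norm x" for x
  proof (cases "f x = 0")
    case False
    have "norm (f x) * norm (f x) = x \<bullet> ?a (f x)"
      by (simp add: adj dot_square_norm power2_eq_square)
    also have "\<dots> \<le> norm x * norm (f x)"
      using norm_cauchy_schwarz[of x "?a (f x)"] by (simp add: norm_a)
    finally show ?thesis using False by simp
  qed simp
  have "f p \<in> frontier S"
  proof -
    have "closed (f -` S)" by (rule closed_vimage[OF S(1) cont(1)])
    then have "f p \<in> S" using p by (auto simp: frontier_def)
    moreover have "f p \<notin> interior S"
    proof
      assume "f p \<in> interior S"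
      moreover have "open (f -` interior S)" by (rule open_vimage[OF open_interior cont(1)])
      ultimately have "p \<in> interior (f -` S)"
        by (intro interiorI[of "f -` interior S"]) (use interior_subset in auto)
      then show False using p by (simp add: frontier_def)
    qed
    ultimately show ?thesis using S(1) by (simp add: frontier_def)
  qed
  then obtain u g G r where "C1_graph_at S (f p) u g G r"
    using S(2) by (auto simp: C1_boundary_def)
  then have gr: "norm u = 1" "r > 0" "\<And>x t. g (x + t *\<^sub>R u) = g x"
    "\<And>x. (g has_derivative (\<lambda>h. G x \<bullet> h)) (at x)" "continuous_on UNIV G"
    "S \<inter> ball (f p) r = {x \<in> ball (f p) r. x \<bullet> u \<le> g x}"
    by (simp_all add: C1_graph_at_def)
  have "C1_graph_at (f -` S) p (?a u) (\<lambda>x. g (f x)) (\<lambda>x. ?a (G (f x))) r"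
    unfolding C1_graph_at_def
  proof (intro conjI allI)
    show "norm (?a u) = 1" "r > 0" using gr by (simp_all add: norm_a)
    show "g (f (x + t *\<^sub>R ?a u)) = g (f x)" for x t
      by (simp add: linear_add[OF f] linear_scale[OF f] sect gr(3))
    show "((\<lambda>x. g (f x)) has_derivative (\<lambda>h. ?a (G (f x)) \<bullet> h)) (at x)" for x
    proof -
      have "((\<lambda>x. g (f x)) has_derivative (\<lambda>h. G (f x) \<bullet> f h)) (at x)"
        by (rule has_derivative_compose[OF bounded_linear_imp_has_derivative[OF bl] gr(4)])
      moreover have "G (f x) \<bullet> f h = ?a (G (f x)) \<bullet> h" for h
        using adj[of h "G (f x)"] by (simp add: inner_commute)
      ultimately show ?thesis by simp
    qed
    show "continuous_on UNIV (\<lambda>x. ?a (G (f x)))"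
      by (intro continuous_on_compose2[OF cont(2)] continuous_on_compose2[OF gr(5)] cont(1)) auto
    show "f -` S \<inter> ball p r = {x \<in> ball p r. x \<bullet> ?a u \<le> g (f x)}"
    proof -
      have "f x \<in> ball (f p) r" if "x \<in> ball p r" for x
        using that norm_f[of "p - x"] by (simp add: dist_norm linear_diff[OF f])
      then have "f x \<in> S \<longleftrightarrow> f x \<bullet> u \<le> g (f x)" if "x \<in> ball p r" for x
        using gr(6) that by blast
      then show ?thesis by (auto simp: adj)
    qed
  qed
  then show "\<exists>u g G r. C1_graph_at (f -` S) p u g G r" by blast
qed

theorem theorem3p1:
  fixes S :: "(real ^ 2) set" and coord :: "nat \<Rightarrow> 'n::finite"
  assumes "CARD('n) \<ge> 2"
    and "bij_betw coord {1..CARD('n)} UNIV"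
    and "closed S" and "convex S" and "interior S \<noteq> {}" and "C1_boundary S"
  shows "\<forall>lam. -1 < lam \<and> lam < 1 \<longrightarrow>
    ABP_property (axis (coord CARD('n)) 1) lam (cylinder coord S)"
proof (intro allI impI)
  fix lam :: real
  define f :: "real ^ 'n \<Rightarrow> real ^ 2" where "f x = vector [x $ coord 1, x $ coord 2]" for x
  define a :: "real ^ 2 \<Rightarrow> real ^ 'n" where "a y = axis (coord 1) (y $ 1) + axis (coord 2) (y $ 2)" for y
  have "coord 1 \<noteq> coord 2"
    using bij_betw_imp_inj_on[OF assms(2)] assms(1) by (auto dest: inj_onD)
  then have fa: "f (a y) = y" for y
    by (simp add: f_def a_def axis_def vec_eq_iff forall_2)
  have f: "linear f"
    by (rule linearI) (simp_all add: f_def vec_eq_iff forall_2)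
  have "x \<bullet> a y = f x \<bullet> y" for x y
    by (simp add: a_def f_def inner_add_right inner_axis) (simp add: inner_vec_def UNIV_2)
  then have "adjoint f = a" by (intro adjoint_unique) simp
  then have sect: "f (adjoint f y) = y" for y by (simp add: fa)
  have cyl: "cylinder coord S = f -` S" by (auto simp: cylinder_def f_def)
  have "closed (f -` S)"
    using assms(3) f[unfolded linear_conv_bounded_linear] by (intro closed_vimage linear_continuous_on)
  then show "ABP_property (axis (coord CARD('n)) 1) lam (cylinder coord S)"
    unfolding cyl
    by (intro ABP_property_convex_C1 convex_linear_vimage f assms C1_boundary_vimage sect) auto
qed

end
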